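(* Let $k\in\mathbb{Z}_{>0}$ and $a\in\frac k2+\mathbb{Z}$ with $a\ge0$. For $N\ge1$ let $\widetilde{CM}^{N}_{k,a}(q):=\sum_w q^{a_M(w)}$, the sum over all $(k,a)$-Motzkin paths $w$ of length $N$, and set $$CM^{2n+1}_{k,a}(q):=q^{\frac k2 n(n+1)+an(2n+1)}\,\widetilde{CM}^{2n+1}_{k,a}(q^{-1}).$$ Then $\lim_{n\to\infty}CM^{2n+1}_{k,a}(q)=C\Psi_{k,a}(q)$ (as power series in $q$, coefficientwise).
   Context: An $a$-shifted Motzkin path of length $N$ and rank $\frac k2$ is a lattice path from $(0,0)$ to $(N,a(N-1))$ consisting of $N$ steps of the form $(1,j)$ with $j\in\{a-\frac k2,a-\frac k2+1,\dots,a+\frac k2\}$, which never goes below the $x$-axis. A $(k,a)$-Motzkin path is such a path in which each step $(1,j)$ is additionally colored by a subset $T\subseteq\{1,\dots,k\}$ with $\#T=\frac k2-a+j$ (distinct colorings give distinct paths). $a_M(w)$ is the area of the region between the path (as a piecewise linear graph) and the $x$-axis. Colored integers: pairs $m_j$ with $m\in\mathbb{Z}_{\ge0}$ and color $j\in\{1,\dots,k\}$, ordered lexicographically ($m_j<n_\ell$ iff $m<n$, or $m=n$ and $j<\ell$). A $(k,a)$-colored F-partition is a two-rowed array $\begin{pmatrix}a_1&\cdots&a_r\\ b_1&\cdots&b_s\end{pmatrix}$ of colored nonnegative integers, each row strictly decreasing, with $r-s=a-\frac k2$; its weight is $r+\sum a_\ell+\sum b_j$. $C\Psi_{k,a}(q):=\sum_{n\ge0}c\psi_{k,a}(n)q^n$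 where $c\psi_{k,a}(n)$ counts such arrays of weight $n$. *)

theory Defs
  imports
    "HOL-Analysis.Analysis"
    "HOL-Library.Poly_Mapping"
    "HOL-Computational_Algebra.Formal_Power_Series"
begin

text \<open>A lattice path starting at \<open>(0,0)\<close> is given by the list \<open>js\<close> of the vertical
  components of its steps \<open>(1,j)\<close>; its vertices are \<open>(i, path_height js i)\<close>.\<close>

definition path_height :: "real list \<Rightarrow> nat \<Rightarrow> real" where
  "path_height js i = sum_list (take i js)"

definition path_graph :: "real list \<Rightarrow> real \<Rightarrow> real" where
  "path_graph js x = (let i = nat \<lfloor>x\<rfloor> in
     path_height js i + (x - real i) * (path_height js (Suc i) - path_height js i))"

definition path_area :: "real list \<Rightarrow> real" where
  "path_area js =
     measure lborel {(x::real, y::real). 0 \<le> x \<and> x \<le> real (length js) \<and> 0 \<le> y \<and> y \<le> path_graph js x}"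

definition shifted_motzkin_path :: "nat \<Rightarrow> real \<Rightarrow> nat \<Rightarrow> real list \<Rightarrow> bool" where
  "shifted_motzkin_path k a N js \<longleftrightarrow>
     length js = N \<and>
     set js \<subseteq> {a - real k / 2 + real i | i. i \<le> k} \<and>
     path_height js N = a * (real N - 1) \<and>
     (\<forall>i\<le>N. 0 \<le> path_height js i)"

text \<open>A coloured path is the list of its steps \<open>(j, T)\<close>, where \<open>T\<close> is the colour of \<open>(1,j)\<close>.\<close>

definition motzkin_paths :: "nat \<Rightarrow> real \<Rightarrow> nat \<Rightarrow> (real \<times> nat set) list set" where
  "motzkin_paths k a N =
     {w. shifted_motzkin_path k a N (map fst w) \<and>
         (\<forall>(j, T)\<in>set w. T \<subseteq> {1..k} \<and> real (card T) = real k / 2 - a + j)}"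

lemma finite_motzkin_paths: "finite (motzkin_paths k a N)"
proof (rule finite_subset)
  let ?S = "{a - real k / 2 + real i | i. i \<le> k} \<times> Pow {1..k}"
  show "motzkin_paths k a N \<subseteq> {w. set w \<subseteq> ?S \<and> length w = N}"
    unfolding motzkin_paths_def shifted_motzkin_path_def by fastforce
  have "{a - real k / 2 + real i | i. i \<le> k} = (\<lambda>i. a - real k / 2 + real i) ` {..k}"
    by auto
  then show "finite {w. set w \<subseteq> ?S \<and> length w = N}"
    by (intro finite_lists_length_eq) simp
qed

text \<open>Areas may be half-integers and the substitution \<open>q \<rightarrow> q\<^sup>-\<^sup>1\<close> produces negative
  exponents, so the generating functions live in the ring \<open>real \<Rightarrow>\<^sub>0 int\<close> of finite formal
  sums of powers of \<open>q\<close> with real exponents, whose product is convolution.\<close>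

definition q_power :: "real \<Rightarrow> (real \<Rightarrow>\<^sub>0 int)" where
  "q_power e = Poly_Mapping.single e 1"

text \<open>Since \<open>map_key f p\<close> is \<open>lookup p \<circ> f\<close> for injective \<open>f\<close>, this sends \<open>q\<close> to \<open>q\<^sup>-\<^sup>1\<close>.\<close>

definition q_inverse :: "(real \<Rightarrow>\<^sub>0 int) \<Rightarrow> (real \<Rightarrow>\<^sub>0 int)" where
  "q_inverse p = Poly_Mapping.map_key uminus p"

lemma q_inverse_q_power: "q_inverse (q_power e) = q_power (- e)"
  unfolding q_inverse_def q_power_def
  using map_key_single[of "uminus :: real \<Rightarrow> real" "- e" "1::int"] by simp

definition CM_tilde :: "nat \<Rightarrow> real \<Rightarrow> nat \<Rightarrow> (real \<Rightarrow>\<^sub>0 int)" where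
  "CM_tilde k a N = (\<Sum>w\<in>motzkin_paths k a N. q_power (path_area (map fst w)))"

text \<open>\<open>CM_odd k a n\<close> belongs to the paths of length \<open>2n + 1\<close>.\<close>

definition CM_odd :: "nat \<Rightarrow> real \<Rightarrow> nat \<Rightarrow> (real \<Rightarrow>\<^sub>0 int)" where
  "CM_odd k a n =
     q_power (real k / 2 * real n * (real n + 1) + a * real n * (2 * real n + 1)) *
     q_inverse (CM_tilde k a (2 * n + 1))"

text \<open>This only loses no information if all exponents occurring in \<open>p\<close> are natural numbers.\<close>

definition to_fps :: "(real \<Rightarrow>\<^sub>0 int) \<Rightarrow> int fps" where
  "to_fps p = Abs_fps (\<lambda>m. Poly_Mapping.lookup p (real m))"

text \<open>A coloured integer \<open>m\<^sub>j\<close> is the pair \<open>(m, j)\<close>; the order is lexicographic.\<close>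

definition strictly_decreasing :: "(nat \<times> nat) list \<Rightarrow> bool" where
  "strictly_decreasing xs \<longleftrightarrow> sorted_wrt (\<lambda>x y. (y, x) \<in> less_than <*lex*> less_than) xs"

definition F_partitions :: "nat \<Rightarrow> real \<Rightarrow> ((nat \<times> nat) list \<times> (nat \<times> nat) list) set" where
  "F_partitions k a =
     {(as, bs). snd ` set as \<subseteq> {1..k} \<and> snd ` set bs \<subseteq> {1..k} \<and>
        strictly_decreasing as \<and> strictly_decreasing bs \<and>
        real (length as) - real (length bs) = a - real k / 2}"

definition F_weight :: "(nat \<times> nat) list \<times> (nat \<times> nat) list \<Rightarrow> nat" where
  "F_weight P = length (fst P) + sum_list (map fst (fst P)) + sum_list (map fst (snd P))"

lemma finite_F_partitions: "finite {P \<in> F_partitions k a. F_weight P = n}"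
proof (rule finite_subset)
  let ?M = "n + nat \<lceil>\<bar>a - real k / 2\<bar>\<rceil>"
  let ?L = "{xs. set xs \<subseteq> {..n} \<times> {1..k} \<and> length xs \<le> ?M}"
  show "finite (?L \<times> ?L)"
    by (intro finite_SigmaI finite_lists_length_le) auto
  show "{P \<in> F_partitions k a. F_weight P = n} \<subseteq> ?L \<times> ?L"
  proof
    fix P assume P: "P \<in> {P \<in> F_partitions k a. F_weight P = n}"
    obtain as bs where [simp]: "P = (as, bs)" by fastforce
    have entries: "fst x \<le> sum_list (map fst xs)" if "x \<in> set xs" for x and xs :: "(nat \<times> nat) list"
      using member_le_sum_list[of "fst x" "map fst xs"] that by force
    have len: "length as \<le> n" "length bs \<le> ?M"
      and sums: "sum_list (map fst as) \<le> n" "sum_list (map fst bs) \<le> n"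
      using P by (auto simp: F_partitions_def F_weight_def) linarith
    have "set as \<subseteq> {..n} \<times> {1..k}"
    proof
      fix x assume x: "x \<in> set as"
      have "fst x \<le> n" using entries[OF x] sums(1) by linarith
      moreover have "snd x \<in> {1..k}" using P x by (auto simp: F_partitions_def)
      ultimately show "x \<in> {..n} \<times> {1..k}" by (cases x) simp
    qed
    moreover have "set bs \<subseteq> {..n} \<times> {1..k}"
    proof
      fix x assume x: "x \<in> set bs"
      have "fst x \<le> n" using entries[OF x] sums(2) by linarith
      moreover have "snd x \<in> {1..k}" using P x by (auto simp: F_partitions_def)
      ultimately show "x \<in> {..n} \<times> {1..k}" by (cases x) simp
    qed
    ultimately show "P \<in> ?L \<times> ?L" using len by simp
  qed
qed

definition C_Psi :: "nat \<Rightarrow> real \<Rightarrow> int fps" where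
  "C_Psi k a = Abs_fps (\<lambda>n. int (card {P \<in> F_partitions k a. F_weight P = n}))"

end

theory Submission
  imports Defs
begin

text \<open>Compare a path of length \<open>2n + 1\<close> with the path that takes all \<open>k\<close> colours in each of its
  first \<open>n\<close> steps and none afterwards. The colours missing from the first \<open>n\<close> steps and the extra
  colours of the later steps, each recorded with the distance of its step from the middle, form the
  two rows of an F-partition, and the amount by which the area falls short of the normalising
  exponent is exactly its weight. An F-partition of weight \<open>m\<close> can only move the
  path near the middle, where it is high; hence for \<open>n \<ge> 2m\<close> every such F-partition comes
  from a path that stays above the axis, and the coefficients of \<open>q\<^sup>m\<close> agree.\<close>

section \<open>The area of a lattice path\<close>

lemma path_height_eq_sum:
  "i \<le> length js \<Longrightarrow> path_height js i = (\<Sum>l<i. js ! l)"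
  unfolding path_height_def by (simp add: sum_list_sum_nth atLeast0LessThan)

text \<open>At the right endpoint the floor already selects the next segment, but both segments meet
  there. Having the closed interval lets adjacent integrals be glued.\<close>

lemma path_graph_on_unit_interval:
  assumes "x \<in> {real i..real (Suc i)}"
  shows "path_graph js x =
    path_height js i + (x - real i) * (path_height js (Suc i) - path_height js i)"
proof (cases "x = real (Suc i)")
  case True
  have "nat \<lfloor>x\<rfloor> = Suc i"
    using True by linarith
  then show ?thesis
    using True unfolding path_graph_def Let_def by simp
next
  case False
  then have "nat \<lfloor>x\<rfloor> = i"
    using assms by (simp add: floor_eq_iff nat_eq_iff)
  then show ?thesis
    unfolding path_graph_def Let_def by simp
qed

lemma path_graph_has_integral:
  "(path_graph js has_integral
     (\<Sum>i<m. (path_height js i + path_height js (Suc i)) / 2)) {0..real m}"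
proof (induction m)
  case 0
  then show ?case
    by (simp add: has_integral_refl)
next
  case (Suc m)
  let ?h = "path_height js m" and ?h' = "path_height js (Suc m)"
  let ?F = "\<lambda>x. ?h * x + (?h' - ?h) * (x - real m)\<^sup>2 / 2"
  have "((\<lambda>x. ?h + (x - real m) * (?h' - ?h)) has_integral ?F (real (Suc m)) - ?F (real m))
      {real m..real (Suc m)}"
    by (intro fundamental_theorem_of_calculus)
      (auto intro!: derivative_eq_intros simp: has_real_derivative_iff_has_vector_derivative [symmetric])
  moreover have "?F (real (Suc m)) - ?F (real m) = (?h + ?h') / 2"
    by (simp add: field_simps)
  ultimately have "((\<lambda>x. ?h + (x - real m) * (?h' - ?h)) has_integral (?h + ?h') / 2)
      {real m..real (Suc m)}"
    by (simp only:)
  then have "(path_graph js has_integral (?h + ?h') / 2) {real m..real (Suc m)}"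
    by (rule has_integral_eq [rotated]) (use path_graph_on_unit_interval in simp)
  then have "(path_graph js has_integral
      (\<Sum>i<m. (path_height js i + path_height js (Suc i)) / 2) + (?h + ?h') / 2) {0..real (Suc m)}"
    by (intro has_integral_combine [OF _ _ Suc.IH]) auto
  then show ?case
    by simp
qed

lemma path_height_eventually_constant:
  "length js \<le> i \<Longrightarrow> path_height js i = path_height js (length js)"
  unfolding path_height_def by simp

text \<open>On each segment the graph is a convex combination of two vertex heights; past the last
  vertex \<open>take\<close> saturates, so the heights there equal the final one.\<close>

lemma path_graph_nonneg:
  assumes "\<forall>i\<le>length js. 0 \<le> path_height js i" and "0 \<le> x"
  shows "0 \<le> path_graph js x"
proof -
  define i where "i = nat \<lfloor>x\<rfloor>"
  have x: "x - real i \<ge> 0" "x - real i \<le> 1"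
    using assms(2) unfolding i_def by linarith+
  have h: "0 \<le> path_height js l" for l
    using assms(1) path_height_eventually_constant [of js l] by (cases "l \<le> length js") auto
  have "path_graph js x = (1 - (x - real i)) * path_height js i + (x - real i) * path_height js (Suc i)"
    unfolding path_graph_def Let_def i_def [symmetric] by (simp add: algebra_simps)
  also have "\<dots> \<ge> 0"
    using x h by (intro add_nonneg_nonneg mult_nonneg_nonneg) auto
  finally show ?thesis .
qed

lemma borel_measurable_path_graph [measurable]: "path_graph js \<in> borel_measurable borel"
  unfolding path_graph_def Let_def by measurable

text \<open>Tonelli: the vertical slice over \<open>x\<close> is the interval from 0 to
  \<open>path_graph js x\<close>, whose length is that value because the graph is nonnegative. What
  remains is the integral of the graph.\<close>

lemma path_area_trapezoids:
  assumes "\<forall>i\<le>length js. 0 \<le> path_height js i"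
  shows "path_area js = (\<Sum>i<length js. (path_height js i + path_height js (Suc i)) / 2)"
    (is "_ = ?I")
proof -
  let ?S = "{(x::real, y::real). 0 \<le> x \<and> x \<le> real (length js) \<and> 0 \<le> y \<and> y \<le> path_graph js x}"
  have "{p \<in> space (borel \<Otimes>\<^sub>M borel). 0 \<le> fst p \<and> fst p \<le> real (length js) \<and>
      0 \<le> snd p \<and> snd p \<le> path_graph js (fst p)} \<in> sets (borel \<Otimes>\<^sub>M (borel :: real measure))"
    by measurable
  moreover have "{p \<in> space (borel \<Otimes>\<^sub>M borel). 0 \<le> fst p \<and> fst p \<le> real (length js) \<and>
      0 \<le> snd p \<and> snd p \<le> path_graph js (fst p)} = ?S"
    by (auto simp: space_pair_measure)
  ultimately have S: "?S \<in> sets (lborel \<Otimes>\<^sub>M (lborel :: real measure))"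
    by (simp add: lborel_prod borel_prod)
  have "emeasure lborel ?S = emeasure (lborel \<Otimes>\<^sub>M (lborel :: real measure)) ?S"
    by (simp add: lborel_prod)
  also have "\<dots> = (\<integral>\<^sup>+x. emeasure lborel (Pair x -` ?S) \<partial>lborel)"
    by (rule lborel.emeasure_pair_measure_alt [OF S])
  also have "\<dots> = (\<integral>\<^sup>+x. ennreal (indicator {0..real (length js)} x * path_graph js x) \<partial>lborel)"
  proof (intro nn_integral_cong)
    fix x :: real
    have "Pair x -` ?S = (if x \<in> {0..real (length js)} then {0..path_graph js x} else {})"
      by auto
    then show "emeasure lborel (Pair x -` ?S) =
        ennreal (indicator {0..real (length js)} x * path_graph js x)"
      using path_graph_nonneg [OF assms] by auto
  qed
  also have "\<dots> = ennreal ?I"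
    by (rule nn_integral_has_integral_lebesgue [OF _ path_graph_has_integral])
      (use path_graph_nonneg [OF assms] in auto)
  finally have "emeasure lborel ?S = ennreal ?I" .
  moreover have "0 \<le> ?I"
    using assms by (intro sum_nonneg) auto
  ultimately show ?thesis
    unfolding path_area_def measure_def by simp
qed

text \<open>Step \<open>i\<close> lifts each of the \<open>m - i - 1\<close> later trapezoids by
  \<open>f i\<close> and its own by half of that.\<close>

lemma sum_trapezoids_of_partial_sums:
  fixes f :: "nat \<Rightarrow> real"
  shows "(\<Sum>i<m. ((\<Sum>l<i. f l) + (\<Sum>l<Suc i. f l)) / 2) = (\<Sum>i<m. f i * (real m - real i - 1/2))"
proof (induction m)
  case (Suc m)
  have "(\<Sum>i<m. f i * (real (Suc m) - real i - 1/2)) =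
      (\<Sum>i<m. f i * (real m - real i - 1/2)) + (\<Sum>i<m. f i)"
    by (simp add: algebra_simps flip: sum.distrib)
  then show ?case
    using Suc.IH by (simp add: field_simps)
qed simp

text \<open>Makes the area linear in the steps, so that deviations from the comparison path can be
  added up.\<close>

lemma path_area_eq:
  assumes "\<forall>i\<le>length js. 0 \<le> path_height js i"
  shows "path_area js = (\<Sum>i<length js. js ! i * (real (length js) - real i - 1/2))"
proof -
  have "path_area js = (\<Sum>i<length js. ((\<Sum>l<i. js ! l) + (\<Sum>l<Suc i. js ! l)) / 2)"
    unfolding path_area_trapezoids [OF assms]
    by (intro sum.cong refl) (simp only: path_height_eq_sum lessThan_iff less_imp_le Suc_leI)
  then show ?thesis
    by (simp only: sum_trapezoids_of_partial_sums)
qed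

section \<open>Paths and pairs of rows\<close>

lemma strictly_decreasing_Cons:
  "strictly_decreasing (x # xs) \<longleftrightarrow>
     (\<forall>y\<in>set xs. (y, x) \<in> less_than <*lex*> less_than) \<and> strictly_decreasing xs"
  unfolding strictly_decreasing_def by simp

lemma strictly_decreasing_distinct: "strictly_decreasing xs \<Longrightarrow> distinct xs"
  by (induction xs) (auto simp: strictly_decreasing_Cons)

lemma strictly_decreasing_unique:
  "strictly_decreasing xs \<Longrightarrow> strictly_decreasing ys \<Longrightarrow> set xs = set ys \<Longrightarrow> xs = ys"
proof (induction xs arbitrary: ys)
  case (Cons x xs)
  then obtain y ys' where ys: "ys = y # ys'"
    by (cases ys) auto
  let ?R = "less_than <*lex*> less_than"
  have irrefl: "(z, z) \<notin> ?R" for z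
    by (cases z) auto
  have asym: "(z, u) \<in> ?R \<Longrightarrow> (u, z) \<notin> ?R" for z u
    by (cases z; cases u) auto
  have x: "\<forall>z\<in>set xs. (z, x) \<in> ?R" "strictly_decreasing xs"
    and y: "\<forall>z\<in>set ys'. (z, y) \<in> ?R" "strictly_decreasing ys'"
    and eq: "insert x (set xs) = insert y (set ys')"
    using Cons.prems by (simp_all add: ys strictly_decreasing_Cons del: in_lex_prod)
  \<comment> \<open>Both heads are the largest element of the common set.\<close>
  have "x = y"
  proof (rule ccontr)
    assume "x \<noteq> y"
    then have "x \<in> set ys'" "y \<in> set xs"
      using eq by (metis insertE insertI1)+
    then show False
      using asym x(1) y(1) by (meson bspec)
  qed
  moreover have "x \<notin> set xs" "y \<notin> set ys'"
    using irrefl x(1) y(1) by (meson bspec)+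
  then have "set xs = set ys'"
    using eq \<open>x = y\<close> by (simp add: insert_ident)
  ultimately show ?case
    using Cons.IH [OF x(2) y(2)] ys by simp
qed simp

lemma strictly_decreasing_exists:
  assumes "finite A"
  shows "\<exists>xs. strictly_decreasing xs \<and> set xs = A"
  using assms
proof (induction A)
  case empty
  show ?case
    by (auto simp: strictly_decreasing_def)
next
  case (insert x A)
  let ?R = "less_than <*lex*> less_than"
  obtain xs where xs: "strictly_decreasing xs" "set xs = A"
    using insert.IH by blast
  \<comment> \<open>The new element goes between the larger and the smaller ones; since the order is
    total, the two filters lose nothing.\<close>
  let ?ys = "filter (\<lambda>y. (x, y) \<in> ?R) xs @ x # filter (\<lambda>y. (y, x) \<in> ?R) xs"
  have via_x: "(u, x) \<in> ?R \<Longrightarrow> (x, w) \<in> ?R \<Longrightarrow> (u, w) \<in> ?R" for u w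
    by (rule transD [OF trans_lex_prod [OF trans_less_than trans_less_than]])
  have "strictly_decreasing ?ys"
    using xs(1) unfolding strictly_decreasing_def sorted_wrt_append
    by (auto intro: sorted_wrt_filter via_x simp del: in_lex_prod)
  moreover have "(x, y) \<in> ?R \<or> (y, x) \<in> ?R" if "y \<in> A" for y
  proof -
    have "x \<noteq> y"
      using that insert.hyps by blast
    then show ?thesis
      by (cases x; cases y) auto
  qed
  then have "set ?ys = insert x A"
    using xs(2) by auto
  ultimately show ?case
    by blast
qed

lemma sum_lessThan_add:
  fixes f :: "nat \<Rightarrow> 'a::comm_monoid_add"
  shows "sum f {..<m + n} = sum f {..<m} + (\<Sum>i<n. f (m + i))"
  by (induction n) (auto simp: ac_simps)

text \<open>Steps are counted from 0. \<open>A\<close> holds the missing colours of the steps \<open>i < n\<close> and \<open>B\<close> the extra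
  colours of the steps \<open>i \<ge> n\<close>, so that both distances start at 0.\<close>

definition step_colours :: "nat \<Rightarrow> nat \<Rightarrow> (nat \<times> nat) set \<Rightarrow> (nat \<times> nat) set \<Rightarrow> nat \<Rightarrow> nat set" where
  "step_colours k n A B i =
     (if i < n then {c \<in> {1..k}. (n - Suc i, c) \<notin> A} else {c \<in> {1..k}. (i - n, c) \<in> B})"

text \<open>The colouring condition forces the vertical component of a step once its colour set is
  known.\<close>

definition path_of_rows ::
    "nat \<Rightarrow> real \<Rightarrow> nat \<Rightarrow> (nat \<times> nat) list \<times> (nat \<times> nat) list \<Rightarrow> (real \<times> nat set) list" where
  "path_of_rows k a n P =
     map (\<lambda>i. let T = step_colours k n (set (fst P)) (set (snd P)) i in
            (real (card T) + a - real k / 2, T)) [0..<2 * n + 1]"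

text \<open>The bounds differ because \<open>n\<close> steps precede step \<open>n\<close>, while
  \<open>n + 1\<close> steps start from it.\<close>

definition bounded_rows :: "nat \<Rightarrow> nat \<Rightarrow> ((nat \<times> nat) list \<times> (nat \<times> nat) list) set" where
  "bounded_rows k n =
     {(as, bs). strictly_decreasing as \<and> strictly_decreasing bs \<and>
        set as \<subseteq> {..<n} \<times> {1..k} \<and> set bs \<subseteq> {..n} \<times> {1..k}}"

text \<open>End point and nonnegativity are left out, so that these walks correspond exactly to
  \<open>bounded_rows\<close>; both conditions are imposed afterwards.\<close>

definition coloured_walks :: "nat \<Rightarrow> real \<Rightarrow> nat \<Rightarrow> (real \<times> nat set) list set" where
  "coloured_walks k a N =
     {w. length w = N \<and> (\<forall>(j, T)\<in>set w. T \<subseteq> {1..k} \<and> real (card T) = real k / 2 - a + j)}"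

lemma step_colours_subset: "step_colours k n A B i \<subseteq> {1..k}"
  unfolding step_colours_def by auto

text \<open>The range of admissible steps follows from the colouring: a step coloured by
  \<open>T\<close> is \<open>a - k/2 + card T\<close>, and \<open>card T\<close> is at most
  \<open>k\<close>.\<close>

lemma motzkin_paths_eq:
  "motzkin_paths k a N =
     {w \<in> coloured_walks k a N. path_height (map fst w) N = a * (real N - 1) \<and>
        (\<forall>i\<le>N. 0 \<le> path_height (map fst w) i)}"
proof -
  have steps: "fst ` set w \<subseteq> {a - real k / 2 + real i | i. i \<le> k}"
    if "\<forall>(j, T)\<in>set w. T \<subseteq> {1..k} \<and> real (card T) = real k / 2 - a + j"
    for w :: "(real \<times> nat set) list"
  proof
    fix j assume "j \<in> fst ` set w"
    then obtain T where "(j, T) \<in> set w"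
      by auto
    then have T: "T \<subseteq> {1..k}" "real (card T) = real k / 2 - a + j"
      using that by auto
    have "card T \<le> k"
      using card_mono [OF finite_atLeastAtMost T(1)] by simp
    then show "j \<in> {a - real k / 2 + real i | i. i \<le> k}"
      using T(2) by (intro CollectI exI [of _ "card T"]) auto
  qed
  show ?thesis
  proof (rule set_eqI)
    fix w
    show "w \<in> motzkin_paths k a N \<longleftrightarrow>
        w \<in> {w \<in> coloured_walks k a N. path_height (map fst w) N = a * (real N - 1) \<and>
          (\<forall>i\<le>N. 0 \<le> path_height (map fst w) i)}"
      using steps [of w]
      unfolding motzkin_paths_def coloured_walks_def shifted_motzkin_path_def
        mem_Collect_eq set_map length_map
      by argo
  qed
qed

text \<open>The colour sets of the steps recover each row as a set, and a strictly decreasing row is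
  determined by its set.\<close>

lemma bij_betw_path_of_rows:
  "bij_betw (path_of_rows k a n) (bounded_rows k n) (coloured_walks k a (2 * n + 1))"
  unfolding bij_betw_def
proof
  have nth_path: "snd (path_of_rows k a n P ! i) = step_colours k n (set (fst P)) (set (snd P)) i"
    if "i < 2 * n + 1" for P i
    using that unfolding path_of_rows_def by (simp add: Let_def del: upt_Suc)
  show "inj_on (path_of_rows k a n) (bounded_rows k n)"
  proof (rule inj_onI, clarify)
    fix as bs as' bs'
    assume P: "(as, bs) \<in> bounded_rows k n" and P': "(as', bs') \<in> bounded_rows k n"
      and eq: "path_of_rows k a n (as, bs) = path_of_rows k a n (as', bs')"
    have steps: "step_colours k n (set as) (set bs) i = step_colours k n (set as') (set bs') i"
      if "i < 2 * n + 1" for i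
      using eq nth_path [OF that, of "(as, bs)"] nth_path [OF that, of "(as', bs')"] by simp
    have "(m, c) \<in> set as \<longleftrightarrow> (m, c) \<in> set as'" if "m < n" "c \<in> {1..k}" for m c
    proof -
      have "c \<in> step_colours k n (set as) (set bs) (n - Suc m) \<longleftrightarrow>
          c \<in> step_colours k n (set as') (set bs') (n - Suc m)"
        using steps [of "n - Suc m"] that by simp
      then show ?thesis
        using that by (simp add: step_colours_def Suc_diff_Suc)
    qed
    then have "set as = set as'"
      using P P' unfolding bounded_rows_def by auto
    moreover have "(m, c) \<in> set bs \<longleftrightarrow> (m, c) \<in> set bs'" if "m \<le> n" "c \<in> {1..k}" for m c
    proof -
      have "c \<in> step_colours k n (set as) (set bs) (n + m) \<longleftrightarrow>
          c \<in> step_colours k n (set as') (set bs') (n + m)"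
        using steps [of "n + m"] that by simp
      then show ?thesis
        using that by (simp add: step_colours_def)
    qed
    then have "set bs = set bs'"
      using P P' unfolding bounded_rows_def by auto
    ultimately show "as = as' \<and> bs = bs'"
      using P P' unfolding bounded_rows_def by (auto intro: strictly_decreasing_unique)
  qed
  show "path_of_rows k a n ` bounded_rows k n = coloured_walks k a (2 * n + 1)"
  proof
    show "path_of_rows k a n ` bounded_rows k n \<subseteq> coloured_walks k a (2 * n + 1)"
      by (auto simp: coloured_walks_def path_of_rows_def Let_def simp del: upt_Suc
          dest!: subsetD [OF step_colours_subset])
    show "coloured_walks k a (2 * n + 1) \<subseteq> path_of_rows k a n ` bounded_rows k n"
    proof
      fix w assume w: "w \<in> coloured_walks k a (2 * n + 1)"
      \<comment> \<open>The preimage is read off the walk: \<open>A\<close> collects missing colours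
        before step \<open>n\<close>, \<open>B\<close> the colours present from step
        \<open>n\<close> on.\<close>
      define A where "A = {(m, c) \<in> {..<n} \<times> {1..k}. c \<notin> snd (w ! (n - Suc m))}"
      define B where "B = {(m, c) \<in> {..n} \<times> {1..k}. c \<in> snd (w ! (n + m))}"
      have AB: "A \<subseteq> {..<n} \<times> {1..k}" "B \<subseteq> {..n} \<times> {1..k}"
        unfolding A_def B_def by auto
      then have "finite A" "finite B"
        using finite_subset [OF AB(1)] finite_subset [OF AB(2)] by simp_all
      then obtain as bs where rows: "strictly_decreasing as" "set as = A"
          "strictly_decreasing bs" "set bs = B"
        using strictly_decreasing_exists [of A] strictly_decreasing_exists [of B] by blast
      have wi: "snd (w ! i) \<subseteq> {1..k} \<and> real (card (snd (w ! i))) = real k / 2 - a + fst (w ! i)"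
        if "i < 2 * n + 1" for i
      proof -
        have "w ! i \<in> set w"
          using w that by (simp add: coloured_walks_def)
        moreover have "\<forall>p\<in>set w. snd p \<subseteq> {1..k} \<and> real (card (snd p)) = real k / 2 - a + fst p"
          using w unfolding coloured_walks_def by fastforce
        ultimately show ?thesis
          by blast
      qed
      have steps: "step_colours k n A B i = snd (w ! i)" if "i < 2 * n + 1" for i
        using wi [OF that] that by (auto simp: step_colours_def A_def B_def Suc_diff_Suc)
      have "path_of_rows k a n (as, bs) = w"
      proof (rule nth_equalityI)
        show "length (path_of_rows k a n (as, bs)) = length w"
          using w by (simp add: path_of_rows_def coloured_walks_def)
        fix i assume "i < length (path_of_rows k a n (as, bs))"
        then have i: "i < 2 * n + 1"
          by (simp add: path_of_rows_def)
        then show "path_of_rows k a n (as, bs) ! i = w ! i"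
          using wi [OF i] steps [OF i] rows
          by (simp add: path_of_rows_def Let_def prod_eq_iff del: upt_Suc)
      qed
      moreover have "(as, bs) \<in> bounded_rows k n"
        using rows AB by (simp add: bounded_rows_def)
      ultimately show "w \<in> path_of_rows k a n ` bounded_rows k n"
        by (auto simp: image_iff intro!: bexI [of _ "(as, bs)"])
    qed
  qed
qed

section \<open>Excess over the comparison path, row lengths and weight\<close>

lemma sum_over_fibres:
  fixes f :: "'a \<Rightarrow> real"
  assumes "finite I" "finite K" "A \<subseteq> I \<times> K"
  shows "(\<Sum>p\<in>A. f (fst p)) = (\<Sum>m\<in>I. real (card {c \<in> K. (m, c) \<in> A}) * f m)"
proof -
  have "A = Sigma I (\<lambda>m. {c \<in> K. (m, c) \<in> A})"
    using assms(3) by auto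
  then have "(\<Sum>p\<in>A. f (fst p)) = (\<Sum>p\<in>Sigma I (\<lambda>m. {c \<in> K. (m, c) \<in> A}). f (fst p))"
    by simp
  also have "\<dots> = (\<Sum>m\<in>I. \<Sum>c\<in>{c \<in> K. (m, c) \<in> A}. f m)"
    using assms by (subst sum.Sigma) (auto simp: split_def)
  finally show ?thesis
    by simp
qed

text \<open>Used with \<open>f = 1\<close> for the row lengths and with \<open>f i = i - n\<close> for the weight.\<close>

lemma sum_excess:
  fixes f :: "nat \<Rightarrow> real"
  assumes "(as, bs) \<in> bounded_rows k n"
  shows "(\<Sum>i<2 * n + 1. (real (card (step_colours k n (set as) (set bs) i)) -
             (if i < n then real k else 0)) * f i) =
         sum_list (map (\<lambda>p. f (n + fst p)) bs) - sum_list (map (\<lambda>p. f (n - Suc (fst p))) as)"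
proof -
  let ?T = "step_colours k n (set as) (set bs)"
  let ?g = "\<lambda>i. (real (card (?T i)) - (if i < n then real k else 0)) * f i"
  have as: "set as \<subseteq> {..<n} \<times> {1..k}" "strictly_decreasing as"
    and bs: "set bs \<subseteq> {..n} \<times> {1..k}" "strictly_decreasing bs"
    using assms by (auto simp: bounded_rows_def)
  \<comment> \<open>The entries \<open>(m, c)\<close> of the upper row are removed from a full step,
    which gives the minus sign.\<close>
  have missing: "real (card (?T (n - Suc m))) - real k = - real (card {c \<in> {1..k}. (m, c) \<in> set as})"
    if "m < n" for m
  proof -
    define M where "M = {c \<in> {1..k}. (m, c) \<in> set as}"
    have M: "M \<subseteq> {1..k}" "finite M"
      by (auto simp: M_def)
    have "?T (n - Suc m) = {1..k} - M"
      using that by (auto simp: M_def step_colours_def Suc_diff_Suc)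
    then have "card (?T (n - Suc m)) = card {1..k} - card M"
      using card_Diff_subset [OF M(2,1)] by (simp only:)
    moreover have "card M \<le> card {1..k}"
      by (rule card_mono [OF finite_atLeastAtMost M(1)])
    ultimately have "real (card (?T (n - Suc m))) = real k - real (card M)"
      by (simp only: of_nat_diff card_atLeastAtMost)
    then show ?thesis
      unfolding M_def by linarith
  qed
  have "sum_list (map (\<lambda>p. f (n - Suc (fst p))) as) = (\<Sum>p\<in>set as. f (n - Suc (fst p)))"
    by (intro sum_list_distinct_conv_sum_set strictly_decreasing_distinct as)
  also have "\<dots> = (\<Sum>m<n. real (card {c \<in> {1..k}. (m, c) \<in> set as}) * f (n - Suc m))"
    by (intro sum_over_fibres [where f = "\<lambda>m. f (n - Suc m)"] as) auto
  also have "\<dots> = (\<Sum>m<n. - ?g (n - Suc m))"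
  proof (intro sum.cong refl)
    fix m assume "m \<in> {..<n}"
    then have m: "m < n" "n - Suc m < n"
      by auto
    show "real (card {c \<in> {1..k}. (m, c) \<in> set as}) * f (n - Suc m) = - ?g (n - Suc m)"
      by (simp only: m if_True missing [OF m(1)] mult_minus_left minus_minus)
  qed
  also have "\<dots> = - (\<Sum>i<n. ?g i)"
    unfolding sum_negf sum.nat_diff_reindex [of ?g] by (rule refl)
  finally have upper: "sum_list (map (\<lambda>p. f (n - Suc (fst p))) as) = - (\<Sum>i<n. ?g i)" .
  have "sum_list (map (\<lambda>p. f (n + fst p)) bs) = (\<Sum>p\<in>set bs. f (n + fst p))"
    by (intro sum_list_distinct_conv_sum_set strictly_decreasing_distinct bs)
  also have "\<dots> = (\<Sum>m\<le>n. real (card {c \<in> {1..k}. (m, c) \<in> set bs}) * f (n + m))"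
    by (intro sum_over_fibres [where f = "\<lambda>m. f (n + m)"] bs) auto
  also have "\<dots> = (\<Sum>m<n + 1. ?g (n + m))"
    by (intro sum.cong) (auto simp: step_colours_def)
  finally have lower: "sum_list (map (\<lambda>p. f (n + fst p)) bs) = (\<Sum>m<n + 1. ?g (n + m))" .
  have "(\<Sum>i<2 * n + 1. ?g i) = (\<Sum>i<n. ?g i) + (\<Sum>m<n + 1. ?g (n + m))"
    using sum_lessThan_add [of ?g n "n + 1"] by (simp add: mult_2)
  with upper lower show ?thesis
    by linarith
qed

lemma path_height_path_of_rows:
  assumes "i \<le> 2 * n + 1"
  shows "path_height (map fst (path_of_rows k a n P)) i =
    (\<Sum>l<i. real (card (step_colours k n (set (fst P)) (set (snd P)) l)) + a - real k / 2)"
proof -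
  have "path_height (map fst (path_of_rows k a n P)) i =
      (\<Sum>l<i. map fst (path_of_rows k a n P) ! l)"
    using assms by (intro path_height_eq_sum) (simp add: path_of_rows_def)
  also have "\<dots> = (\<Sum>l<i. real (card (step_colours k n (set (fst P)) (set (snd P)) l)) + a - real k / 2)"
    using assms by (intro sum.cong) (simp_all add: path_of_rows_def Let_def del: upt_Suc)
  finally show ?thesis .
qed

lemma sum_first_half:
  fixes g :: "nat \<Rightarrow> real"
  shows "(\<Sum>i<2 * n + 1. if i < n then g i else 0) = (\<Sum>i<n. g i)"
proof -
  have "{..<2 * n + 1} \<inter> {i. i < n} = {..<n}"
    by auto
  then show ?thesis
    by (simp add: sum.If_cases del: sum.lessThan_Suc)
qed

lemma sum_lessThan_diff: "(\<Sum>i<m. x - real i) = real m * x - real m * (real m - 1) / 2"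
  by (induction m) (auto simp: field_simps)

text \<open>The walk uses \<open>n * k\<close> colours, plus the length of \<open>bs\<close>, minus
  that of \<open>as\<close>. Adding the \<open>2 * n + 1\<close> shifts by \<open>a - k/2\<close>
  and comparing with \<open>2 * n * a\<close> leaves the condition on the lengths.\<close>

lemma final_height_iff:
  assumes "(as, bs) \<in> bounded_rows k n"
  shows "path_height (map fst (path_of_rows k a n (as, bs))) (2 * n + 1) = a * (real (2 * n + 1) - 1)
    \<longleftrightarrow> real (length as) - real (length bs) = a - real k / 2"
proof -
  let ?t = "\<lambda>i. real (card (step_colours k n (set as) (set bs) i))"
  have "(\<Sum>i<2 * n + 1. ?t i) - real n * real k = real (length bs) - real (length as)"
    using sum_excess [OF assms, of "\<lambda>_. 1"] sum_first_half [of n "\<lambda>_. real k"]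
    by (simp add: sum_subtractf sum_list_triv del: sum.lessThan_Suc)
  moreover have "path_height (map fst (path_of_rows k a n (as, bs))) (2 * n + 1) =
      (\<Sum>i<2 * n + 1. ?t i) + real (2 * n + 1) * (a - real k / 2)"
    by (subst path_height_path_of_rows)
      (simp_all add: sum.distrib sum_subtractf algebra_simps del: sum.lessThan_Suc)
  ultimately show ?thesis
    by (simp add: field_simps) linarith
qed

lemma F_weight_eq:
  "F_weight (as, bs) = sum_list (map (\<lambda>p. Suc (fst p)) as) + sum_list (map fst bs)"
proof -
  have "length as + sum_list (map fst as) = sum_list (map (\<lambda>p. Suc (fst p)) as)"
    by (induction as) auto
  then show ?thesis
    unfolding F_weight_def by simp
qed

text \<open>A colour missing at step \<open>n - Suc m\<close> contributes
  \<open>(-1) * -(m + 1)\<close>, an extra colour at step \<open>n + m\<close> contributes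
  \<open>m\<close>. The additional 1 per upper entry is the summand \<open>length as\<close> in the
  weight.\<close>

lemma F_weight_eq_sum:
  assumes "(as, bs) \<in> bounded_rows k n"
  shows "real (F_weight (as, bs)) = (\<Sum>i<2 * n + 1. (real (card (step_colours k n (set as) (set bs) i)) -
             (if i < n then real k else 0)) * (real i - real n))"
proof -
  have "sum_list (map (\<lambda>p. real (n - Suc (fst p)) - real n) as) =
      - real (sum_list (map (\<lambda>p. Suc (fst p)) as))"
    if "set as \<subseteq> {..<n} \<times> {1..k}"
    using that by (induction as) auto
  moreover have "sum_list (map (\<lambda>p. real (n + fst p) - real n) bs) = real (sum_list (map fst bs))"
    by (induction bs) auto
  ultimately show ?thesis
    using assms by (subst sum_excess) (auto simp: F_weight_eq bounded_rows_def)
qed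

section \<open>Area and weight\<close>

text \<open>The exponent with which a path enters \<open>CM_odd\<close>.\<close>

definition area_defect :: "nat \<Rightarrow> real \<Rightarrow> nat \<Rightarrow> real list \<Rightarrow> real" where
  "area_defect k a n js =
     real k / 2 * real n * (real n + 1) + a * real n * (2 * real n + 1) - path_area js"

lemma area_defect_path_of_rows:
  assumes rows: "(as, bs) \<in> bounded_rows k n"
    and final: "real (length as) - real (length bs) = a - real k / 2"
    and nonneg: "\<forall>i\<le>2 * n + 1. 0 \<le> path_height (map fst (path_of_rows k a n (as, bs))) i"
  shows "area_defect k a n (map fst (path_of_rows k a n (as, bs))) = real (F_weight (as, bs))"
proof -
  define c where "c i = real (card (step_colours k n (set as) (set bs) i)) -
    (if i < n then real k else 0)" for i
  let ?x = "2 * real n + 1 / 2"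
  let ?js = "map fst (path_of_rows k a n (as, bs))"
  have len: "length ?js = 2 * n + 1"
    by (simp add: path_of_rows_def)
  have excess: "(\<Sum>i<2 * n + 1. c i) = real k / 2 - a"
    using sum_excess [OF rows, of "\<lambda>_. 1"] final
    by (simp add: c_def sum_list_triv del: sum.lessThan_Suc)
  have weight: "(\<Sum>i<2 * n + 1. c i * (real i - real n)) = real (F_weight (as, bs))"
    using F_weight_eq_sum [OF rows] by (simp add: c_def del: sum.lessThan_Suc)
  \<comment> \<open>The factor \<open>2n + 1/2 - i\<close> is split as
    \<open>(n + 1/2) - (i - n)\<close>: the first part meets the total excess, the second the
    weight. The other terms belong to the comparison path.\<close>
  have summand: "?js ! i * (real (2 * n + 1) - real i - 1/2) =
      (real n + 1/2) * c i - c i * (real i - real n) + (if i < n then real k * (?x - real i) else 0)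
        + (a - real k / 2) * (?x - real i)" if "i < 2 * n + 1" for i
    using that by (simp add: c_def path_of_rows_def Let_def algebra_simps del: upt_Suc)
  have "path_area ?js = (\<Sum>i<2 * n + 1. ?js ! i * (real (2 * n + 1) - real i - 1/2))"
    using path_area_eq [of ?js] nonneg unfolding len by blast
  also have "\<dots> = (\<Sum>i<2 * n + 1.
      (real n + 1/2) * c i - c i * (real i - real n) + (if i < n then real k * (?x - real i) else 0)
        + (a - real k / 2) * (?x - real i))"
    by (intro sum.cong refl summand) simp
  also have "\<dots> = (real n + 1/2) * (real k / 2 - a) - real (F_weight (as, bs))
      + real k * (\<Sum>i<n. ?x - real i) + (a - real k / 2) * (\<Sum>i<2 * n + 1. ?x - real i)"
    unfolding sum.distrib sum_subtractf [where f = "\<lambda>i. (real n + 1/2) * c i"]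
      sum_distrib_left [symmetric] sum_first_half excess weight by (rule refl)
  finally have "path_area ?js = \<dots>" .
  then show ?thesis
    unfolding area_defect_def sum_lessThan_diff by (simp add: field_simps)
qed

text \<open>A unit of excess at step \<open>l\<close> weighs its distance \<open>\<bar>l - n\<bar>\<close> from the middle, so up to step \<open>i \<le> n\<close>
  the path loses height at most \<open>m / (n + 1 - i)\<close>. This is at most \<open>i / 2\<close> because
  \<open>i (n + 1 - i) \<ge> n \<ge> 2m\<close>, whereas the unperturbed path has height at least \<open>i / 2\<close>. The second half
  is symmetric.\<close>

lemma bounded_defect_heights_nonneg:
  fixes c :: "nat \<Rightarrow> real" and a :: real
  assumes "k > 0" and "a \<ge> 0"
    and neg: "\<And>i. i < n \<Longrightarrow> c i \<le> 0" and pos: "\<And>i. n \<le> i \<Longrightarrow> 0 \<le> c i"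
    and weight: "(\<Sum>i<2 * n + 1. c i * (real i - real n)) \<le> m" and "2 * m \<le> real n"
    and excess: "(\<Sum>i<2 * n + 1. c i) = real k / 2 - a"
    and "i \<le> 2 * n + 1"
  shows "0 \<le> (\<Sum>l<i. c l + (if l < n then real k else 0) + a - real k / 2)"
proof -
  \<comment> \<open>\<open>c l\<close> and \<open>l - n\<close> never have opposite signs, so any
    partial sum of these products is at most \<open>m\<close>.\<close>
  have nonneg: "0 \<le> c l * (real l - real n)" for l
    using neg [of l] pos [of l] by (cases "l < n") (auto intro: mult_nonpos_nonpos)
  have part: "(\<Sum>l\<in>L. c l * (real l - real n)) \<le> m" if "L \<subseteq> {..<2 * n + 1}" for L
    using sum_mono2 [OF _ that, of "\<lambda>l. c l * (real l - real n)"] nonneg weight by fastforce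
  have small: "X \<le> real p / 2"
    if "1 \<le> p" "p \<le> n" "X * (real n + 1 - real p) \<le> m" for X p
  proof -
    \<comment> \<open>This product equals \<open>p * (n + 1 - p) - n\<close>.\<close>
    have "0 \<le> (real p - 1) * (real n - real p)"
      using that by (intro mult_nonneg_nonneg) auto
    then have "real n \<le> real p * (real n + 1 - real p)"
      by (simp add: algebra_simps)
    then have "X * (real n + 1 - real p) \<le> real p / 2 * (real n + 1 - real p)"
      using that(3) assms(6) by simp
    then show ?thesis
      using that(2) by (subst (asm) mult_le_cancel_right) auto
  qed
  show ?thesis
  proof (cases "i \<le> n")
    case True
    let ?X = "\<Sum>l<i. c l"
    have eq: "(\<Sum>l<i. c l + (if l < n then real k else 0) + a - real k / 2) =
        ?X + real i * (a + real k / 2)"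
    proof -
      have "(\<Sum>l<i. c l + (if l < n then real k else 0) + a - real k / 2) =
          (\<Sum>l<i. c l + (a + real k / 2))"
        using True by (intro sum.cong) auto
      then show ?thesis
        by (simp add: sum.distrib)
    qed
    have "- ?X \<le> real i / 2"
    proof (cases "i = 0")
      case False
      have "- ?X * (real n + 1 - real i) = (\<Sum>l<i. c l * (real i - 1 - real n))"
        unfolding sum_distrib_right [symmetric] by (simp add: algebra_simps)
      \<comment> \<open>Each \<open>l < i\<close> has distance at least \<open>n + 1 - i\<close>
        from \<open>n\<close>, and \<open>c l\<close> is not positive.\<close>
      also have "\<dots> \<le> (\<Sum>l<i. c l * (real l - real n))"
        using True neg by (intro sum_mono mult_left_mono_neg) auto
      also have "\<dots> \<le> m"
        using True by (intro part) auto
      finally show ?thesis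
        using False True by (intro small) auto
    qed simp
    moreover have "real i / 2 \<le> real i * (a + real k / 2)"
      using mult_left_mono [of "1/2" "a + real k / 2" "real i"] assms(1,2) by simp
    ultimately show ?thesis
      unfolding eq by linarith
  next
    case False
    \<comment> \<open>\<open>p\<close> counts the remaining steps. The height at \<open>i\<close> is
      the final height \<open>2 * n * a\<close> minus the rise over these steps, on which
      \<open>l - n\<close> is at least \<open>n + 1 - p\<close>.\<close>
    define p where "p = 2 * n + 1 - i"
    have i: "i = 2 * n + 1 - p" "p \<le> n" "real i = 2 * real n + 1 - real p"
      using False assms(8) by (auto simp: p_def of_nat_diff)
    let ?f = "\<lambda>l. c l + (if l < n then real k else 0) + a - real k / 2"
    let ?Y = "\<Sum>l\<in>{i..<2 * n + 1}. c l"
    have "(\<Sum>l<2 * n + 1. ?f l) = (\<Sum>l<2 * n + 1. c l) + (\<Sum>l<2 * n + 1. if l < n then real k else 0)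
        + real (2 * n + 1) * a - real (2 * n + 1) * (real k / 2)"
      by (simp only: sum.distrib sum_subtractf sum_constant card_lessThan)
    also have "\<dots> = 2 * real n * a"
      unfolding excess sum_first_half by (simp add: field_simps)
    finally have total: "(\<Sum>l<2 * n + 1. ?f l) = 2 * real n * a" .
    have split: "(\<Sum>l<2 * n + 1. ?f l) = (\<Sum>l<i. ?f l) + (\<Sum>l\<in>{i..<2 * n + 1}. ?f l)"
      using sum.atLeastLessThan_concat [of 0 i "2 * n + 1" ?f] assms(8)
      by (simp only: lessThan_atLeast0)
    have "(\<Sum>l\<in>{i..<2 * n + 1}. ?f l) = (\<Sum>l\<in>{i..<2 * n + 1}. c l + (a - real k / 2))"
      using False by (intro sum.cong) auto
    also have "\<dots> = ?Y + real p * (a - real k / 2)"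
      by (simp only: sum.distrib sum_constant card_atLeastLessThan p_def)
    finally have rest: "(\<Sum>l\<in>{i..<2 * n + 1}. ?f l) = ?Y + real p * (a - real k / 2)" .
    have "?Y \<le> real p / 2"
    proof (cases "p = 0")
      case True
      then show ?thesis
        by (simp add: i)
    next
      case p: False
      have "?Y * (real n + 1 - real p) = (\<Sum>l\<in>{i..<2 * n + 1}. c l * (real i - real n))"
        unfolding i(3) sum_distrib_right [symmetric] by (simp add: algebra_simps)
      also have "\<dots> \<le> (\<Sum>l\<in>{i..<2 * n + 1}. c l * (real l - real n))"
        using False pos by (intro sum_mono mult_left_mono) auto
      also have "\<dots> \<le> m"
        by (intro part) auto
      finally show ?thesis
        using p i by (intro small) auto
    qed
    moreover have "real p / 2 \<le> real p * (real k / 2)"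
      using mult_left_mono [of "1/2" "real k / 2" "real p"] assms(1) by simp
    moreover have "real p * a \<le> 2 * real n * a"
      using i(2) assms(2) by (intro mult_right_mono) auto
    \<comment> \<open>The height is \<open>(2 * n - p) * a + (p * k / 2 - ?Y)\<close>, and both
      summands are nonnegative.\<close>
    ultimately show ?thesis
      using total split rest by (simp add: right_diff_distrib)
  qed
qed

section \<open>Coefficients and the correspondence at fixed weight\<close>

lemma q_inverse_sum: "q_inverse (\<Sum>x\<in>A. f x) = (\<Sum>x\<in>A. q_inverse (f x))"
  unfolding q_inverse_def
  by (induction A rule: infinite_finite_induct) (auto simp: map_key_plus)

lemma lookup_CM_odd:
  "Poly_Mapping.lookup (CM_odd k a n) e =
     int (card {w \<in> motzkin_paths k a (2 * n + 1). area_defect k a n (map fst w) = e})"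
proof -
  have "CM_odd k a n = (\<Sum>w\<in>motzkin_paths k a (2 * n + 1).
      Poly_Mapping.single (area_defect k a n (map fst w)) 1)"
    unfolding CM_odd_def CM_tilde_def q_inverse_sum q_inverse_q_power
    by (simp add: sum_distrib_left q_power_def mult_single area_defect_def)
  then show ?thesis
    by (simp add: lookup_sum lookup_single when_def sum.If_cases finite_motzkin_paths Int_def
        eq_commute [of e])
qed

text \<open>This direction holds for every \<open>n\<close>, so it also shows that all exponents in
  \<open>CM_odd\<close> are natural numbers.\<close>

lemma motzkin_paths_odd_cases:
  assumes "w \<in> motzkin_paths k a (2 * n + 1)"
  obtains as bs where "w = path_of_rows k a n (as, bs)" "(as, bs) \<in> bounded_rows k n"
    "(as, bs) \<in> F_partitions k a" "area_defect k a n (map fst w) = real (F_weight (as, bs))"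
proof -
  have "w \<in> coloured_walks k a (2 * n + 1)"
    using assms by (simp only: motzkin_paths_eq mem_Collect_eq)
  then obtain as bs where w: "w = path_of_rows k a n (as, bs)" and P: "(as, bs) \<in> bounded_rows k n"
    using bij_betw_imp_surj_on [OF bij_betw_path_of_rows, of k a n] by force
  have length: "real (length as) - real (length bs) = a - real k / 2"
    and nonneg: "\<forall>i\<le>2 * n + 1. 0 \<le> path_height (map fst w) i"
    using assms final_height_iff [OF P, of a] by (auto simp only: motzkin_paths_eq mem_Collect_eq w)
  have "(as, bs) \<in> F_partitions k a"
    using P length by (auto simp: bounded_rows_def F_partitions_def)
  then show ?thesis
    using that w P area_defect_path_of_rows [OF P length] nonneg by blast
qed

text \<open>An upper entry \<open>m\<close> costs \<open>m + 1\<close> of the weight and a lower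
  entry costs \<open>m\<close>, which matches the two bounds.\<close>

lemma F_partition_bounded_rows:
  assumes "P \<in> F_partitions k a" and "F_weight P \<le> n"
  shows "P \<in> bounded_rows k n"
proof -
  obtain as bs where P: "P = (as, bs)"
    by fastforce
  have "Suc (fst p) \<le> n" if "p \<in> set as" for p
    using member_le_sum_list [of "Suc (fst p)" "map (\<lambda>p. Suc (fst p)) as"] that assms(2)
    by (auto simp: P F_weight_eq)
  moreover have "fst p \<le> n" if "p \<in> set bs" for p
    using member_le_sum_list [of "fst p" "map fst bs"] that assms(2)
    by (auto simp: P F_weight_eq)
  ultimately show ?thesis
    using assms(1) by (force simp: P bounded_rows_def F_partitions_def)
qed

text \<open>The row lengths give the correct end point. Nonnegativity comes from
  \<open>bounded_defect_heights_nonneg\<close>, applied to the excess \<open>c\<close> with total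
  \<open>k/2 - a\<close> and weighted sum \<open>F_weight P\<close>.\<close>

lemma path_of_F_partition_motzkin:
  assumes "k > 0" and "a \<ge> 0" and P: "P \<in> F_partitions k a" and weight: "2 * F_weight P \<le> n"
  shows "path_of_rows k a n P \<in> motzkin_paths k a (2 * n + 1)"
proof -
  obtain as bs where eq: "P = (as, bs)"
    by fastforce
  have rows: "(as, bs) \<in> bounded_rows k n"
    using F_partition_bounded_rows [OF P, of n] weight by (simp add: eq)
  have length: "real (length as) - real (length bs) = a - real k / 2"
    using P by (simp add: eq F_partitions_def)
  let ?t = "\<lambda>i. card (step_colours k n (set as) (set bs) i)"
  define c where "c i = real (?t i) - (if i < n then real k else 0)" for i
  have le: "?t i \<le> k" for i
    using card_mono [OF _ step_colours_subset [of k n "set as" "set bs" i]] by simp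
  have "0 \<le> (\<Sum>l<i. c l + (if l < n then real k else 0) + a - real k / 2)" if "i \<le> 2 * n + 1" for i
  proof (rule bounded_defect_heights_nonneg [where m = "real (F_weight P)"])
    show "(\<Sum>i<2 * n + 1. c i * (real i - real n)) \<le> real (F_weight P)"
      using F_weight_eq_sum [OF rows] by (simp add: eq c_def del: sum.lessThan_Suc)
    show "(\<Sum>i<2 * n + 1. c i) = real k / 2 - a"
      using sum_excess [OF rows, of "\<lambda>_. 1"] length
      by (simp add: c_def sum_list_triv del: sum.lessThan_Suc)
  qed (use assms that le weight in \<open>auto simp: c_def\<close>)
  then have "\<forall>i\<le>2 * n + 1. 0 \<le> path_height (map fst (path_of_rows k a n P)) i"
    by (auto simp: path_height_path_of_rows c_def eq)
  moreover have "path_of_rows k a n P \<in> coloured_walks k a (2 * n + 1)"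
    using bij_betwE [OF bij_betw_path_of_rows] rows eq by blast
  moreover have "path_height (map fst (path_of_rows k a n P)) (2 * n + 1) =
      a * (real (2 * n + 1) - 1)"
    using final_height_iff [OF rows] length eq by blast
  ultimately show ?thesis
    unfolding motzkin_paths_eq by blast
qed

lemma card_motzkin_paths_eq_card_F_partitions:
  assumes "k > 0" and "a \<ge> 0" and "2 * m \<le> n"
  shows "card {w \<in> motzkin_paths k a (2 * n + 1). area_defect k a n (map fst w) = real m} =
    card {P \<in> F_partitions k a. F_weight P = m}" (is "card ?W = card ?P")
proof -
  have inj: "inj_on (path_of_rows k a n) (bounded_rows k n)"
    using bij_betw_path_of_rows bij_betw_imp_inj_on by blast
  have rows: "?P \<subseteq> bounded_rows k n"
    using F_partition_bounded_rows assms(3) by fastforce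
  have "path_of_rows k a n ` ?P = ?W"
  proof
    show "path_of_rows k a n ` ?P \<subseteq> ?W"
    proof (rule image_subsetI)
      fix P assume P: "P \<in> ?P"
      then have w: "path_of_rows k a n P \<in> motzkin_paths k a (2 * n + 1)"
        using assms by (intro path_of_F_partition_motzkin) auto
      \<comment> \<open>The area formula is available for some rows \<open>P'\<close> producing this
        path; injectivity identifies them with \<open>P\<close>.\<close>
      then obtain P' where P': "path_of_rows k a n P = path_of_rows k a n P'" "P' \<in> bounded_rows k n"
        "area_defect k a n (map fst (path_of_rows k a n P)) = real (F_weight P')"
        by (rule motzkin_paths_odd_cases) blast
      have "P' = P"
        using inj_onD [OF inj P'(1)] P P'(2) rows by blast
      then show "path_of_rows k a n P \<in> ?W"
        using w P P'(3) by simp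
    qed
    show "?W \<subseteq> path_of_rows k a n ` ?P"
    proof
      fix w assume "w \<in> ?W"
      then have w: "w \<in> motzkin_paths k a (2 * n + 1)" "area_defect k a n (map fst w) = real m"
        by auto
      from w(1) show "w \<in> path_of_rows k a n ` ?P"
        by (rule motzkin_paths_odd_cases) (use w(2) in auto)
    qed
  qed
  then show ?thesis
    using card_image [OF inj_on_subset [OF inj rows]] by simp
qed

text \<open>The claim about \<open>keys\<close> ensures that \<open>to_fps\<close> discards nothing,
  so the limit concerns all of \<open>CM_odd\<close>.\<close>

theorem theorem3:
  fixes k :: nat and a :: real
  assumes "k > 0" and "a - real k / 2 \<in> \<int>" and "a \<ge> 0"
  shows "(\<forall>n. Poly_Mapping.keys (CM_odd k a n) \<subseteq> \<nat>) \<and>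
         (\<lambda>n. to_fps (CM_odd k a n)) \<longlonglongrightarrow> C_Psi k a"
proof (intro conjI allI subsetI)
  fix n e assume "e \<in> Poly_Mapping.keys (CM_odd k a n)"
  then have "card {w \<in> motzkin_paths k a (2 * n + 1). area_defect k a n (map fst w) = e} \<noteq> 0"
    by (simp add: in_keys_iff lookup_CM_odd)
  then obtain w where "w \<in> motzkin_paths k a (2 * n + 1)" "area_defect k a n (map fst w) = e"
    by (metis (mono_tags, lifting) card.empty empty_Collect_eq)
  then show "e \<in> \<nat>"
    by (metis motzkin_paths_odd_cases of_nat_in_Nats)
next
  show "(\<lambda>n. to_fps (CM_odd k a n)) \<longlonglongrightarrow> C_Psi k a"
  \<comment> \<open>Each coefficient is eventually constant: that of \<open>q^m\<close> agrees with
    its limit from \<open>n = 2 * m\<close> on.\<close>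
  proof (rule tendsto_fpsI)
    fix m
    show "\<forall>\<^sub>F n in sequentially. fps_nth (to_fps (CM_odd k a n)) m = fps_nth (C_Psi k a) m"
      using eventually_ge_at_top [of "2 * m"]
    proof eventually_elim
      case (elim n)
      then show ?case
        using assms by (simp only: to_fps_def C_Psi_def fps_nth_Abs_fps lookup_CM_odd
            card_motzkin_paths_eq_card_F_partitions)
    qed
  qed
qed

end
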